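(* Let $\Sigma_f$ be a rotational Ricci surface in $\mathbb{R}^3$, where $f:I\to\mathbb{R}$ is a positive smooth function on an open interval $I\subseteq\mathbb{R}$ defined by $$f(s(t))=adt\exp\left(-\int_{t_0}^t\frac{\tau}{\tau^2-\tau-\frac{b}{a^2}}\,d\tau\right),$$ where $$s(t)=d\exp\left(-\int_{t_0}^t\frac{\tau}{\tau^2-\tau-\frac{b}{a^2}}\,d\tau\right)-\frac cb,$$ for some $a,b,c,d\in\mathbb{R}$ with $a\neq0$, $b\neq0$ and $t_0\in J:=\{t\in\mathbb{R}: s(t)\in I\}$. Suppose that the Gaussian curvature $K$ of $\Sigma_f$ does not vanish identically. Then $$J\subseteq\left\{t\in\mathbb{R}:-1\le\frac{b}{at}+a\le1\right\}\cap\left\{t\in\mathbb{R}:t^2-t-\frac{b}{a^2}\neq0\right\}.$$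
   Context: Rotational surfaces: let $I\subseteq\mathbb{R}$ be an open interval, and let $f,g:I\to\mathbb{R}$ be smooth with $f>0$, $(f')^2+(g')^2=1$ and $g'\ge 0$. The rotational surface $\Sigma_f\subset\mathbb{R}^3$ is the surface parametrised by $X(s,\theta)=(f(s)\cos\theta,f(s)\sin\theta,g(s))$; its profile curve is $\alpha(s)=(f(s),0,g(s))$, parametrised by arc length. In particular $|f'|\le 1$, and, up to a vertical isometry of $\mathbb{R}^3$, $g(s)=\int_{s_0}^s\sqrt{1-f'(\zeta)^2}\,d\zeta$ with $s_0\in I$, so $\Sigma_f$ is determined by $f$. The induced metric is $ds^2+f(s)^2d\theta^2$ and the Gaussian curvature is $K=-f''/f$. A rotational Ricci surface is a rotational surface $\Sigma_f$ whose Gaussian curvature satisfies the Ricci condition $K\Delta K-\|\nabla K\|^2-4K^3=0$, equivalently $KK''-(K')^2-4K^3+\frac{f'}{f}KK'=0$ with $K=-f''/f$. The variable $t$ is a reparametrisation of the profile curve, $s=s(t)$; the displayed formula for $f(s(t))$ holds for all $t\in J$. *)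

theory Defs
  imports "HOL-Analysis.Analysis"
begin

text \<open>
  A surface patch is a map \<open>X :: real \<Rightarrow> real \<Rightarrow> real ^ 3\<close> of two parameters, and a function on the
  surface is represented by its expression in these parameters.
\<close>

definition pd1 :: "(real \<Rightarrow> real \<Rightarrow> 'v::real_normed_vector) \<Rightarrow> real \<Rightarrow> real \<Rightarrow> 'v" where
  "pd1 h u v = vector_derivative (\<lambda>x. h x v) (at u)"

definition pd2 :: "(real \<Rightarrow> real \<Rightarrow> 'v::real_normed_vector) \<Rightarrow> real \<Rightarrow> real \<Rightarrow> 'v" where
  "pd2 h u v = vector_derivative (\<lambda>y. h u y) (at v)"

definition fff_E :: "(real \<Rightarrow> real \<Rightarrow> real ^ 3) \<Rightarrow> real \<Rightarrow> real \<Rightarrow> real" where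
  "fff_E X u v = pd1 X u v \<bullet> pd1 X u v"

definition fff_F :: "(real \<Rightarrow> real \<Rightarrow> real ^ 3) \<Rightarrow> real \<Rightarrow> real \<Rightarrow> real" where
  "fff_F X u v = pd1 X u v \<bullet> pd2 X u v"

definition fff_G :: "(real \<Rightarrow> real \<Rightarrow> real ^ 3) \<Rightarrow> real \<Rightarrow> real \<Rightarrow> real" where
  "fff_G X u v = pd2 X u v \<bullet> pd2 X u v"

definition fff_det :: "(real \<Rightarrow> real \<Rightarrow> real ^ 3) \<Rightarrow> real \<Rightarrow> real \<Rightarrow> real" where
  "fff_det X u v = fff_E X u v * fff_G X u v - (fff_F X u v)\<^sup>2"

definition unit_normal :: "(real \<Rightarrow> real \<Rightarrow> real ^ 3) \<Rightarrow> real \<Rightarrow> real \<Rightarrow> real ^ 3" where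
  "unit_normal X u v = sgn (cross3 (pd1 X u v) (pd2 X u v))"

text \<open>The quotient of the determinants of the second and the first fundamental form.\<close>

definition gauss_curvature :: "(real \<Rightarrow> real \<Rightarrow> real ^ 3) \<Rightarrow> real \<Rightarrow> real \<Rightarrow> real" where
  "gauss_curvature X u v =
     ((pd1 (pd1 X) u v \<bullet> unit_normal X u v) * (pd2 (pd2 X) u v \<bullet> unit_normal X u v)
       - (pd1 (pd2 X) u v \<bullet> unit_normal X u v)\<^sup>2) / fff_det X u v"

text \<open>
  The squared norm of the gradient and the Laplace--Beltrami operator (the divergence of the gradient)
  of the metric \<open>E du\<^sup>2 + 2 F du dv + G dv\<^sup>2\<close>, in coordinates.
\<close>

definition grad_norm2 ::
    "(real \<Rightarrow> real \<Rightarrow> real ^ 3) \<Rightarrow> (real \<Rightarrow> real \<Rightarrow> real) \<Rightarrow> real \<Rightarrow> real \<Rightarrow> real" where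
  "grad_norm2 X h u v =
     (fff_G X u v * (pd1 h u v)\<^sup>2 - 2 * fff_F X u v * pd1 h u v * pd2 h u v
       + fff_E X u v * (pd2 h u v)\<^sup>2) / fff_det X u v"

definition laplace_beltrami ::
    "(real \<Rightarrow> real \<Rightarrow> real ^ 3) \<Rightarrow> (real \<Rightarrow> real \<Rightarrow> real) \<Rightarrow> real \<Rightarrow> real \<Rightarrow> real" where
  "laplace_beltrami X h u v =
     (pd1 (\<lambda>x y. (fff_G X x y * pd1 h x y - fff_F X x y * pd2 h x y) / sqrt (fff_det X x y)) u v
      + pd2 (\<lambda>x y. (fff_E X x y * pd2 h x y - fff_F X x y * pd1 h x y) / sqrt (fff_det X x y)) u v)
     / sqrt (fff_det X u v)"

text \<open>For open \<open>I\<close>. The values of \<open>f\<close> outside \<open>I\<close> are irrelevant.\<close>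

definition smooth_on_interval :: "real set \<Rightarrow> (real \<Rightarrow> real) \<Rightarrow> bool" where
  "smooth_on_interval I f \<longleftrightarrow> (\<forall>n. (deriv ^^ n) f differentiable_on I)"

definition rot_surface :: "(real \<Rightarrow> real) \<Rightarrow> (real \<Rightarrow> real) \<Rightarrow> real \<Rightarrow> real \<Rightarrow> real ^ 3" where
  "rot_surface f g s \<theta> = vector [f s * cos \<theta>, f s * sin \<theta>, g s]"

definition rotational_surface :: "real set \<Rightarrow> (real \<Rightarrow> real) \<Rightarrow> (real \<Rightarrow> real) \<Rightarrow> bool" where
  "rotational_surface I f g \<longleftrightarrow>
     open I \<and> is_interval I \<and> I \<noteq> {} \<and>
     smooth_on_interval I f \<and> smooth_on_interval I g \<and>
     (\<forall>s\<in>I. f s > 0 \<and> (deriv f s)\<^sup>2 + (deriv g s)\<^sup>2 = 1 \<and> deriv g s \<ge> 0)"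

definition rotational_ricci_surface :: "real set \<Rightarrow> (real \<Rightarrow> real) \<Rightarrow> (real \<Rightarrow> real) \<Rightarrow> bool" where
  "rotational_ricci_surface I f g \<longleftrightarrow>
     rotational_surface I f g \<and>
     (\<forall>s\<in>I. \<forall>\<theta>.
        let X = rot_surface f g; K = gauss_curvature X
        in K s \<theta> * laplace_beltrami X K s \<theta> - grad_norm2 X K s \<theta> - 4 * (K s \<theta>) ^ 3 = 0)"

definition ricci_integrand :: "real \<Rightarrow> real \<Rightarrow> real \<Rightarrow> real" where
  "ricci_integrand a b \<tau> = \<tau> / (\<tau>\<^sup>2 - \<tau> - b / a\<^sup>2)"

text \<open>The integral is oriented: for \<open>t < t0\<close> it is minus the integral from \<open>t\<close> to \<open>t0\<close>.\<close>

definition ricci_exp :: "real \<Rightarrow> real \<Rightarrow> real \<Rightarrow> real \<Rightarrow> real" where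
  "ricci_exp a b t0 t = exp (- (LBINT \<tau>=ereal t0..ereal t. ricci_integrand a b \<tau>))"

definition arc_param :: "real \<Rightarrow> real \<Rightarrow> real \<Rightarrow> real \<Rightarrow> real \<Rightarrow> real \<Rightarrow> real" where
  "arc_param a b c d t0 t = d * ricci_exp a b t0 t - c / b"

text \<open>
  The set \<open>J\<close>. The value \<open>s(t)\<close> is meaningful only if the integral from \<open>t0\<close> to \<open>t\<close> exists. As the
  library gives a divergent integral the value \<open>0\<close>, the existence is a separate condition.
  It holds trivially for \<open>t = t0\<close>, even if the denominator vanishes there.
\<close>

definition param_domain ::
    "real \<Rightarrow> real \<Rightarrow> real \<Rightarrow> real \<Rightarrow> real \<Rightarrow> real set \<Rightarrow> real set" where
  "param_domain a b c d t0 I =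
     {t. interval_lebesgue_integrable lborel (ereal t0) (ereal t) (ricci_integrand a b)
         \<and> arc_param a b c d t0 t \<in> I}"

end

theory Submission
  imports Defs
begin

text \<open>
  The integrand has a non-integrable singularity at every zero of the denominator, since \<open>b \<noteq> 0\<close>
  excludes the zero \<open>0\<close>. Hence the denominator does not vanish between \<open>t\<^sub>0\<close> and any other
  \<open>t \<in> J\<close>. If it vanished at \<open>t\<^sub>0\<close>, then \<open>J = {t\<^sub>0}\<close> and the open set \<open>I\<close> would be a
  single point. Therefore \<open>J\<close> is a neighbourhood of each of its points, and differentiating
  \<open>f (s t)\<close> by the chain rule gives \<open>f' (s t) = b / (a t) + a\<close>, which is bounded by \<open>1\<close> in
  absolute value because the profile curve has unit speed.
\<close>

section \<open>Divergence of the integral of \<open>1 / \<bar>x - r\<bar>\<close> at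
  \<open>r\<close>\<close>

text \<open>Since \<open>k\<close> is nonnegative, its integral over \<open>{x..y}\<close> is at
  most the one over the whole interval. So an antiderivative with unbounded differences on the open
  interval rules out integrability.\<close>

lemma antiderivative_diff_le_integral:
  fixes k G :: "real \<Rightarrow> real"
  assumes "k integrable_on {p<..<q}" and "\<And>x. x \<in> {p<..<q} \<Longrightarrow> 0 \<le> k x"
    and "\<And>x. x \<in> {p<..<q} \<Longrightarrow> (G has_real_derivative k x) (at x)"
    and "p < x" "x \<le> y" "y < q"
  shows "G y - G x \<le> integral {p<..<q} k"
proof -
  have "(k has_integral G y - G x) {x..y}"
    using assms(3-6)
    by (intro fundamental_theorem_of_calculus)
       (auto simp flip: has_real_derivative_iff_has_vector_derivative
             intro: has_field_derivative_at_within)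
  then show ?thesis
    by (rule has_integral_subset_le[rotated]) (use assms in \<open>auto intro: integrable_integral\<close>)
qed

text \<open>The antiderivative \<open>ln (x - r)\<close> tends to minus infinity at
  \<open>r\<close>.\<close>

lemma not_integrable_inverse_right:
  fixes r q :: real
  assumes "r < q"
  shows "\<not> (\<lambda>x. 1 / \<bar>x - r\<bar>) integrable_on {r<..<q}"
proof
  assume int: "(\<lambda>x. 1 / \<bar>x - r\<bar>) integrable_on {r<..<q}"
  define M where "M = integral {r<..<q} (\<lambda>x. 1 / \<bar>x - r\<bar>)"
  define h where "h = (q - r) / 2"
  have h: "h > 0" "r + h < q"
    using assms by (auto simp: h_def field_simps)
  \<comment> \<open>Moving from \<open>r + h\<close> to \<open>r + h * e\<close> lowers the
    antiderivative by \<open>\<bar>M\<bar> + 1\<close>, which exceeds \<open>M\<close>.\<close>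
  define e where "e = exp (- (\<bar>M\<bar> + 1))"
  have e: "0 < e" "e \<le> 1"
    by (auto simp: e_def)
  have "ln ((r + h) - r) - ln ((r + h * e) - r) \<le> M"
    unfolding M_def
    by (rule antiderivative_diff_le_integral[OF int])
       (use h e in \<open>auto intro!: derivative_eq_intros simp: divide_simps mult_le_cancel_left1\<close>)
  moreover have "ln (h * e) = ln h - (\<bar>M\<bar> + 1)"
    using h e by (simp add: ln_mult e_def)
  ultimately show False
    by simp
qed

text \<open>Mirror image of the previous argument, with the antiderivative
  \<open>- ln (r - x)\<close>.\<close>

lemma not_integrable_inverse_left:
  fixes p r :: real
  assumes "p < r"
  shows "\<not> (\<lambda>x. 1 / \<bar>x - r\<bar>) integrable_on {p<..<r}"
proof
  assume int: "(\<lambda>x. 1 / \<bar>x - r\<bar>) integrable_on {p<..<r}"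
  define M where "M = integral {p<..<r} (\<lambda>x. 1 / \<bar>x - r\<bar>)"
  define h where "h = (r - p) / 2"
  have h: "h > 0" "p < r - h"
    using assms by (auto simp: h_def field_simps)
  define e where "e = exp (- (\<bar>M\<bar> + 1))"
  have e: "0 < e" "e \<le> 1"
    by (auto simp: e_def)
  have "- ln (r - (r - h * e)) - - ln (r - (r - h)) \<le> M"
    unfolding M_def
    by (rule antiderivative_diff_le_integral[OF int])
       (use h e in \<open>auto intro!: derivative_eq_intros simp: divide_simps mult_le_cancel_left1\<close>)
  moreover have "ln (h * e) = ln h - (\<bar>M\<bar> + 1)"
    using h e by (simp add: ln_mult e_def)
  ultimately show False
    by simp
qed

lemma not_integrable_inverse:
  fixes p q r :: real
  assumes "p < q" and "r = p \<or> r = q"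
  shows "\<not> set_integrable lborel {p<..<q} (\<lambda>x. 1 / \<bar>x - r\<bar>)"
  using assms not_integrable_inverse_right not_integrable_inverse_left
  by (auto dest!: set_borel_integral_eq_integral(1))

section \<open>Singularities of the integrand\<close>

lemma borel_measurable_ricci_integrand [measurable]: "ricci_integrand a b \<in> borel_measurable borel"
  unfolding ricci_integrand_def by measurable

text \<open>The roots of the denominator sum to 1, so it factors as
  \<open>(x - r) * (x + r - 1)\<close>. Near \<open>r \<noteq> 0\<close> the numerator stays away
  from 0 and \<open>x + r - 1\<close> is bounded, so a multiple of the integrand dominates
  \<open>1 / \<bar>x - r\<bar>\<close>. This covers the double root \<open>1 / 2\<close> as
  well.\<close>

lemma not_integrable_ricci_integrand_endpoint:
  assumes "b \<noteq> 0" and "a \<noteq> 0" and root: "r\<^sup>2 - r - b / a\<^sup>2 = 0" and "p < q" and "r = p \<or> r = q"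
  shows "\<not> set_integrable lborel {p<..<q} (ricci_integrand a b)"
proof
  assume int: "set_integrable lborel {p<..<q} (ricci_integrand a b)"
  have r0: "r \<noteq> 0"
    using assms by auto
  \<comment> \<open>Within distance \<open>w\<close> of \<open>r\<close>, the point \<open>x\<close>
    keeps away from 0 and does not meet the other root \<open>1 - r\<close>, which lies at distance
    \<open>\<bar>1 - 2 * r\<bar>\<close>. For a double root there is no other root to avoid, and the
    value 1 is arbitrary.\<close>
  define w where "w = min (\<bar>r\<bar> / 2) (if r = 1 / 2 then 1 else \<bar>1 - 2 * r\<bar>)"
  have w: "w > 0" "w \<le> \<bar>r\<bar> / 2" "r \<noteq> 1 / 2 \<Longrightarrow> w \<le> \<bar>1 - 2 * r\<bar>"
    using r0 by (auto simp: w_def)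
  obtain p' q' where pq: "p \<le> p'" "p' < q'" "q' \<le> q" "r = p' \<or> r = q'" "q' - p' \<le> w"
  proof (cases "r = p")
    case True
    then show thesis
      using that[of p "min q (p + w)"] w \<open>p < q\<close> by auto
  next
    case False
    then show thesis
      using that[of "max p (q - w)" q] w \<open>p < q\<close> assms(5) by auto
  qed
  \<comment> \<open>The constant combines \<open>\<bar>r\<bar> \<le> 2 * \<bar>x\<bar>\<close> with
    \<open>\<bar>x + r - 1\<bar> \<le> 2 * \<bar>r\<bar> + w + 1\<close>.\<close>
  have bound: "1 / \<bar>x - r\<bar> \<le> \<bar>(2 * (2 * \<bar>r\<bar> + w + 1) / \<bar>r\<bar>) * ricci_integrand a b x\<bar>"
    if x: "x \<in> {p'<..<q'}" for x
  proof -
    have xr: "x \<noteq> r" "\<bar>x - r\<bar> < w"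
      using x pq by auto
    have other: "x + r - 1 \<noteq> 0"
      using xr w(3) by (cases "r = 1 / 2") auto
    have xlow: "\<bar>x\<bar> \<ge> \<bar>r\<bar> / 2"
      using xr w(2) by linarith
    have "x\<^sup>2 - x - b / a\<^sup>2 = (x - r) * (x + r - 1)"
      using root by (simp add: algebra_simps power2_eq_square)
    then have eq: "\<bar>ricci_integrand a b x\<bar> = \<bar>x\<bar> / \<bar>x + r - 1\<bar> * (1 / \<bar>x - r\<bar>)"
      by (simp add: ricci_integrand_def abs_mult)
    have "\<bar>r\<bar> * \<bar>x + r - 1\<bar> \<le> (2 * \<bar>x\<bar>) * (2 * \<bar>r\<bar> + w + 1)"
      using xlow xr by (intro mult_mono) auto
    then have "1 \<le> (2 * (2 * \<bar>r\<bar> + w + 1) / \<bar>r\<bar>) * (\<bar>x\<bar> / \<bar>x + r - 1\<bar>)"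
      using r0 other by (simp add: field_simps)
    then have "1 * (1 / \<bar>x - r\<bar>)
        \<le> (2 * (2 * \<bar>r\<bar> + w + 1) / \<bar>r\<bar>) * (\<bar>x\<bar> / \<bar>x + r - 1\<bar>) * (1 / \<bar>x - r\<bar>)"
      by (intro mult_right_mono) auto
    then show ?thesis
      using w(1) by (simp add: abs_mult eq mult_ac)
  qed
  have "set_integrable lborel {p'<..<q'} (ricci_integrand a b)"
    by (rule set_integrable_subset[OF int]) (use pq in auto)
  then have "set_integrable lborel {p'<..<q'}
      (\<lambda>x. (2 * (2 * \<bar>r\<bar> + w + 1) / \<bar>r\<bar>) * ricci_integrand a b x)"
    by (intro set_integrable_mult_right) auto
  then have "set_integrable lborel {p'<..<q'} (\<lambda>x. 1 / \<bar>x - r\<bar>)"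
    by (rule set_integrable_bound)
       (use bound in \<open>auto simp: set_borel_measurable_def intro!: AE_I2\<close>)
  with not_integrable_inverse[OF pq(2,4)] show False
    by blast
qed

text \<open>A root in the closed interval would be an endpoint of a nondegenerate open subinterval,
  to its right or to its left, on which the integrand is still integrable. For \<open>t = t0\<close>
  there is no such subinterval.\<close>

lemma denominator_nonzero_if_ricci_integrable:
  assumes "a \<noteq> 0" and "b \<noteq> 0" and "t \<noteq> t0"
    and int: "interval_lebesgue_integrable lborel (ereal t0) (ereal t) (ricci_integrand a b)"
    and x: "min t0 t \<le> x" "x \<le> max t0 t"
  shows "x\<^sup>2 - x - b / a\<^sup>2 \<noteq> 0"
proof
  assume root: "x\<^sup>2 - x - b / a\<^sup>2 = 0"
  have int': "set_integrable lborel {min t0 t<..<max t0 t} (ricci_integrand a b)"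
    using int by (auto simp: interval_lebesgue_integrable_def min_def max_def split: if_splits)
  show False
  proof (cases "x < max t0 t")
    case True
    have "set_integrable lborel {x<..<max t0 t} (ricci_integrand a b)"
      by (rule set_integrable_subset[OF int']) (use x in auto)
    then show False
      using not_integrable_ricci_integrand_endpoint[OF assms(2,1) root True] by blast
  next
    case False
    then have "min t0 t < x"
      using x \<open>t \<noteq> t0\<close> by linarith
    moreover have "set_integrable lborel {min t0 t<..<x} (ricci_integrand a b)"
      by (rule set_integrable_subset[OF int']) (use x in auto)
    ultimately show False
      using not_integrable_ricci_integrand_endpoint[OF assms(2,1) root] by blast
  qed
qed

section \<open>Local regularity of the parametrisation\<close>

lemma ricci_exp_pos: "ricci_exp a b t0 t > 0"
  by (simp add: ricci_exp_def)

text \<open>By openness the denominator is nonzero on a slightly larger closed interval, where the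
  integrand is continuous. This gives integrability up to all points near \<open>t\<close>, and the
  derivative by the fundamental theorem of calculus.\<close>

lemma ricci_exp_local:
  assumes nz: "\<And>x. min t0 t \<le> x \<Longrightarrow> x \<le> max t0 t \<Longrightarrow> x\<^sup>2 - x - b / a\<^sup>2 \<noteq> 0"
  shows "\<forall>\<^sub>F x in nhds t.
           interval_lebesgue_integrable lborel (ereal t0) (ereal x) (ricci_integrand a b)"
    and "(ricci_exp a b t0 has_real_derivative
            - ricci_integrand a b t * ricci_exp a b t0 t) (at t)"
proof -
  let ?S = "{x::real. x\<^sup>2 - x - b / a\<^sup>2 \<noteq> 0}"
  have "open ?S"
    by (intro open_Collect_neq continuous_intros)
  moreover have "min t0 t \<in> ?S" "max t0 t \<in> ?S"
    using nz by auto
  ultimately obtain e1 e2 where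
    e1: "e1 > 0" "cball (min t0 t) e1 \<subseteq> ?S" and e2: "e2 > 0" "cball (max t0 t) e2 \<subseteq> ?S"
    by (meson open_contains_cball)
  \<comment> \<open>The margins make \<open>t\<close> an interior point of \<open>{l..u}\<close>, so
    that the derivative within this interval is a two-sided one.\<close>
  define l u where "l = min t0 t - e1" and "u = max t0 t + e2"
  have lu: "l < t0" "l < t" "t0 < u" "t < u"
    using e1 e2 by (auto simp: l_def u_def)
  have nz': "x\<^sup>2 - x - b / a\<^sup>2 \<noteq> 0" if "l \<le> x" "x \<le> u" for x
  proof -
    consider "x < min t0 t" | "min t0 t \<le> x \<and> x \<le> max t0 t" | "max t0 t < x"
      by linarith
    then show ?thesis
    proof cases
      case 1
      then have "x \<in> cball (min t0 t) e1"
        using that by (auto simp: l_def dist_real_def)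
      then show ?thesis using e1 by auto
    next
      case 2
      then show ?thesis using nz by auto
    next
      case 3
      then have "x \<in> cball (max t0 t) e2"
        using that by (auto simp: u_def dist_real_def)
      then show ?thesis using e2 by auto
    qed
  qed
  have cont: "continuous_on {l..u} (ricci_integrand a b)"
    unfolding ricci_integrand_def using nz' by (intro continuous_intros) auto
  have "interval_lebesgue_integrable lborel (ereal t0) (ereal x) (ricci_integrand a b)"
    if "x \<in> {l<..<u}" for x
    unfolding interval_lebesgue_integrable_def
    using that lu
    by (auto intro!: set_integrable_subset[OF borel_integrable_atLeastAtMost'[OF cont]])
  then show "\<forall>\<^sub>F x in nhds t.
      interval_lebesgue_integrable lborel (ereal t0) (ereal x) (ricci_integrand a b)"
    using lu by (intro eventually_mono[OF eventually_nhds_in_open[of "{l<..<u}" t]]) auto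
  have "((\<lambda>x. LBINT \<tau>=ereal t0..ereal x. ricci_integrand a b \<tau>) has_vector_derivative
      ricci_integrand a b t) (at t within {l..u})"
    using cont lu by (intro interval_integral_FTC2) auto
  then have "((\<lambda>x. LBINT \<tau>=ereal t0..ereal x. ricci_integrand a b \<tau>) has_real_derivative
      ricci_integrand a b t) (at t)"
    using lu by (simp add: at_within_Icc_at has_real_derivative_iff_has_vector_derivative)
  then show "(ricci_exp a b t0 has_real_derivative
      - ricci_integrand a b t * ricci_exp a b t0 t) (at t)"
    unfolding ricci_exp_def by (auto intro!: derivative_eq_intros)
qed

section \<open>The derivative of the profile function\<close>

lemma profile_deriv_abs_le_1:
  assumes "rotational_surface I f g" and "x \<in> I"
  shows "\<bar>deriv f x\<bar> \<le> 1"
proof -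
  have "(deriv f x)\<^sup>2 \<le> 1"
    using assms unfolding rotational_surface_def
    by (metis le_add_same_cancel1 zero_le_power2)
  then show ?thesis
    by (simp add: abs_square_le_1)
qed

lemma profile_has_deriv:
  assumes "rotational_surface I f g" and "x \<in> I"
  shows "(f has_real_derivative deriv f x) (at x)"
proof -
  have "f differentiable_on I" "open I"
    using assms unfolding rotational_surface_def smooth_on_interval_def
    by (auto dest: spec[of _ 0])
  then have "f differentiable (at x)"
    using assms(2) by (simp add: differentiable_on_eq_differentiable_at)
  then show ?thesis
    by (metis real_differentiable_def DERIV_imp_deriv)
qed

text \<open>Both sides of the formula for \<open>f\<close> along the parametrisation are
  differentiated at \<open>t\<close>. The common factor \<open>d * ricci_exp a b t0 t\<close>
  cancels, which leaves a linear equation for \<open>deriv f\<close>.\<close>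

lemma profile_deriv_param:
  assumes surf: "rotational_surface I f g" and "a \<noteq> 0"
    and fs: "\<forall>t\<in>param_domain a b c d t0 I.
           f (arc_param a b c d t0 t) = a * d * t * ricci_exp a b t0 t"
    and t: "t \<in> param_domain a b c d t0 I" "t \<noteq> 0" "d \<noteq> 0"
    and nz: "\<And>x. min t0 t \<le> x \<Longrightarrow> x \<le> max t0 t \<Longrightarrow> x\<^sup>2 - x - b / a\<^sup>2 \<noteq> 0"
  shows "deriv f (arc_param a b c d t0 t) = b / (a * t) + a"
proof -
  let ?u = "ricci_exp a b t0" and ?s = "arc_param a b c d t0" and ?J = "param_domain a b c d t0 I"
  define h where "h = ricci_integrand a b t"
  define D where "D = t\<^sup>2 - t - b / a\<^sup>2"
  have D: "D \<noteq> 0"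
    using nz[of t] by (auto simp: D_def)
  have h: "h = t / D"
    by (simp add: h_def D_def ricci_integrand_def)
  have u: "(?u has_real_derivative - h * ?u t) (at t)"
    unfolding h_def using nz by (rule ricci_exp_local(2))
  have s: "(?s has_real_derivative - d * h * ?u t) (at t)"
    unfolding arc_param_def by (auto intro!: derivative_eq_intros u)
  have sI: "?s t \<in> I" and "open I"
    using t surf by (auto simp: param_domain_def rotational_surface_def)
  have "isCont ?s t"
    using s by (rule DERIV_isCont)
  then have "\<forall>\<^sub>F x in nhds t. ?s x \<in> I"
    using sI \<open>open I\<close>
    unfolding continuous_at_open eventually_nhds by metis
  moreover have "\<forall>\<^sub>F x in nhds t.
      interval_lebesgue_integrable lborel (ereal t0) (ereal x) (ricci_integrand a b)"
    using nz by (rule ricci_exp_local(1))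
  ultimately have "\<forall>\<^sub>F x in nhds t. x \<in> ?J"
    by eventually_elim (simp add: param_domain_def)
  \<comment> \<open>The formula is given on \<open>?J\<close> only; to differentiate it, it must
    hold on a neighbourhood of \<open>t\<close>.\<close>
  then have ev: "\<forall>\<^sub>F x in nhds t. f (?s x) = a * d * x * ?u x"
    by eventually_elim (use fs in blast)
  have "((\<lambda>x. f (?s x)) has_real_derivative deriv f (?s t) * (- d * h * ?u t)) (at t)"
    using DERIV_chain2[OF profile_has_deriv[OF surf sI] s] .
  moreover have "((\<lambda>x. f (?s x)) has_real_derivative a * d * (?u t - t * h * ?u t)) (at t)"
    by (subst DERIV_cong_ev[OF refl ev refl])
       (auto intro!: derivative_eq_intros u simp: algebra_simps)
  ultimately have "deriv f (?s t) * (- d * h * ?u t) = a * d * (?u t - t * h * ?u t)"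
    by (rule DERIV_unique)
  then have "(d * ?u t) * (deriv f (?s t) * - h) = (d * ?u t) * (a * (1 - t * h))"
    by (simp add: algebra_simps)
  moreover have "d * ?u t \<noteq> 0"
    using t(3) ricci_exp_pos[of a b t0 t] by auto
  ultimately have "deriv f (?s t) * - h = a * (1 - t * h)"
    by (metis mult_left_cancel)
  \<comment> \<open>Substitute \<open>h = t / D\<close> and multiply by \<open>- D\<close>.\<close>
  then have "deriv f (?s t) * t = a * (t\<^sup>2 - D)"
    using D by (simp add: h field_simps power2_eq_square)
  also have "\<dots> = a * t + b / a"
    using \<open>a \<noteq> 0\<close> by (simp add: D_def field_simps power2_eq_square)
  finally show ?thesis
    using \<open>t \<noteq> 0\<close> \<open>a \<noteq> 0\<close> by (simp add: field_simps)
qed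

text \<open>Division by zero yields 0 here, so the condition \<open>t \<noteq> 0\<close> implicit in
  the displayed quotient is made explicit in the conclusion.\<close>

theorem theorem3p8:
  fixes f g :: "real \<Rightarrow> real" and I :: "real set" and a b c d t0 :: real
  assumes "rotational_ricci_surface I f g"
    and "a \<noteq> 0" and "b \<noteq> 0"
    and "t0 \<in> param_domain a b c d t0 I"
    and "arc_param a b c d t0 ` param_domain a b c d t0 I = I"
    and "\<forall>t\<in>param_domain a b c d t0 I.
           f (arc_param a b c d t0 t) = a * d * t * ricci_exp a b t0 t"
    and "\<exists>s\<in>I. \<exists>\<theta>. gauss_curvature (rot_surface f g) s \<theta> \<noteq> 0"
  shows "param_domain a b c d t0 I
           \<subseteq> {t. t \<noteq> 0 \<and> -1 \<le> b / (a * t) + a \<and> b / (a * t) + a \<le> 1}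
             \<inter> {t. t\<^sup>2 - t - b / a\<^sup>2 \<noteq> 0}"
proof
  let ?J = "param_domain a b c d t0 I"
  have surf: "rotational_surface I f g"
    using assms(1) by (simp add: rotational_ricci_surface_def)
  have "\<exists>t1\<in>?J. t1 \<noteq> t0"
  proof (rule ccontr)
    assume "\<not> (\<exists>t1\<in>?J. t1 \<noteq> t0)"
    then have "?J = {t0}"
      using assms(4) by auto
    then have "I = {arc_param a b c d t0 t0}"
      using assms(5) by (metis image_insert image_empty)
    then show False
      using surf not_open_singleton by (auto simp: rotational_surface_def)
  qed
  then obtain t1 where t1: "t1 \<in> ?J" "t1 \<noteq> t0"
    by blast
  \<comment> \<open>The degenerate interval at \<open>t0\<close> says nothing about the denominator;
    the one between \<open>t0\<close> and \<open>t1\<close> has positive length and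
    \<open>t0\<close> as an endpoint.\<close>
  have nz0: "t0\<^sup>2 - t0 - b / a\<^sup>2 \<noteq> 0"
    by (rule denominator_nonzero_if_ricci_integrable[OF assms(2,3) t1(2)])
       (use t1 in \<open>auto simp: param_domain_def\<close>)
  fix t assume t: "t \<in> ?J"
  have nz: "x\<^sup>2 - x - b / a\<^sup>2 \<noteq> 0" if "min t0 t \<le> x" "x \<le> max t0 t" for x
  proof (cases "t = t0")
    case True
    then show ?thesis
      using nz0 that by auto
  next
    case False
    with t that show ?thesis
      by (intro denominator_nonzero_if_ricci_integrable[OF assms(2,3)])
         (auto simp: param_domain_def)
  qed
  have sI: "arc_param a b c d t0 t \<in> I"
    using t by (simp add: param_domain_def)
  then have "f (arc_param a b c d t0 t) > 0"
    using surf by (simp add: rotational_surface_def)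
  \<comment> \<open>The positive value \<open>a * d * t * ricci_exp a b t0 t\<close> has no zero
    factor.\<close>
  then have "t \<noteq> 0" "d \<noteq> 0"
    using assms(6) t by auto
  moreover have "t\<^sup>2 - t - b / a\<^sup>2 \<noteq> 0"
    using nz[of t] by simp
  moreover have "\<bar>b / (a * t) + a\<bar> \<le> 1"
    using profile_deriv_abs_le_1[OF surf sI]
      profile_deriv_param[OF surf assms(2,6) t \<open>t \<noteq> 0\<close> \<open>d \<noteq> 0\<close> nz] by simp
  ultimately show "t \<in> {t. t \<noteq> 0 \<and> -1 \<le> b / (a * t) + a \<and> b / (a * t) + a \<le> 1}
      \<inter> {t. t\<^sup>2 - t - b / a\<^sup>2 \<noteq> 0}"
    by auto
qed

end
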